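(* Let $m$ and $r$ be odd integers and let $x \in \mathbb{Z}_2$. If \[ \nu_{m,r}(x) > \frac{\log 2}{\log m}, \] then $\hat{\Omega}_{m,r}(x)$ exists, i.e. the sequence of rational numbers $(\Omega_{k,m,r}(x))_{k \in \mathbb{N}}$ converges in $\mathbb{R}$ with respect to the usual real metric. If in addition $Q_{m,r}(x)$ is a rational number with odd denominator, then $\hat{\Omega}_{m,r}(x) = \Omega_{m,r}(x)$ (that is, the 2-adic integer $\Omega_{m,r}(x)$ is a rational number with odd denominator, and the real limit $\hat{\Omega}_{m,r}(x)$ equals that same rational number).
   Context: $\mathbb{Z}_2$ denotes the ring of 2-adic integers, and $\mathbb{N} = \{0,1,2,\ldots\}$. The rational numbers with odd denominator (in lowest terms) are regarded both as a subset of $\mathbb{Z}_2$ and as a subset of $\mathbb{R}$; inside $\mathbb{Z}_2$ they are exactly the elements whose 2-adic expansion is eventually periodic. For odd integers $m, r$, the generalized Collatz map $T_{m,r} : \mathbb{Z}_2 \to \mathbb{Z}_2$ is defined by $T_{m,r}(x) = x/2$ if $x \equiv 0 \pmod 2$, and $T_{m,r}(x) = (mx+r)/2$ if $x \equiv 1 \pmod 2$. Write $T_{m,r}^{(k)}$ for its $k$-th iterate ($T_{m,r}^{(0)}$ is the identity). The map $Q_{m,r} : \mathbb{Z}_2 \to \mathbb{Z}_2$ is defined by $Q_{m,r}(x) = \sum_{k \in \mathbb{N}} t_k 2^k$, where $t_k \in \{0,1\}$ and $t_k \equiv T_{m,r}^{(k)}(x) \pmod 2$. The map $Q_{m,r}$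 is a continuous bijection of $\mathbb{Z}_2$ onto itself; write $\Phi_{m,r} = Q_{m,r}^{-1}$. Let $V : \mathbb{Z}_2 \to \mathbb{Z}_2$ be $V(x) = -1-x$. The autoconjugacy map is $\Omega_{m,r} = \Phi_{m,r} \circ V \circ Q_{m,r}$. For $k \in \mathbb{N}$, let $Q_{k,m,r}(x) = \sum_{i<k} t_i 2^i \in \mathbb{N}$ be the sum of the first $k$ terms of the series defining $Q_{m,r}(x)$ (so $Q_{k,m,r}(x) \equiv Q_{m,r}(x) \pmod{2^k}$), and define $\Omega_{k,m,r} = \Phi_{m,r} \circ V \circ Q_{k,m,r}$. For every $x \in \mathbb{Z}_2$ and $k \in \mathbb{N}$, $\Omega_{k,m,r}(x)$ is a rational number with odd denominator, and so may be regarded as a real number. Define \[ \hat{\Omega}_{m,r}(x) = \lim_{k \to \infty} \Omega_{k,m,r}(x) \in \mathbb{R} \] (limit in the real metric) when this limit exists. Finally, define the lower density of even iterates \[ \nu_{m,r}(x) = \liminf_{k \to \infty} \frac1k \Big\lvert \big\{ i \in \mathbb{N} : i < k,\ T_{m,r}^{(i)}(x) \equiv 0 \pmod 2 \big\} \Big\rvert . \] *)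

theory Defs
  imports Complex_Main "HOL-Library.Extended_Real"
begin

section \<open>The ring of 2-adic integers\<close>

text \<open>The inverse limit of the rings of integers modulo \<open>2^n\<close>: a 2-adic integer is a coherent
  sequence of residues, each represented by its least nonnegative representative (that
  \<open>0 \<le> x n < 2 ^ n\<close> is part of the equation below).\<close>

typedef Z2 = "{x :: nat \<Rightarrow> int. \<forall>n. x n = x (Suc n) mod 2 ^ n}"
  morphisms res Abs_Z2
  by (rule exI[of _ "\<lambda>_. 0"]) simp

setup_lifting type_definition_Z2

lemma mod_pow2_Suc_mod: "(a :: int) mod 2 ^ Suc n mod 2 ^ n = a mod 2 ^ n"
  by (rule mod_mod_cancel) simp

lemma res_Suc_mod: "res x (Suc n) mod 2 ^ n = res x n"
  by transfer metis

lemma res_mod: "res x n mod 2 ^ n = res x n"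
  by (metis res_Suc_mod mod_mod_trivial)

lemma res_Abs_Z2:
  assumes "\<And>n. f n = f (Suc n) mod 2 ^ n"
  shows "res (Abs_Z2 f) n = f n"
proof -
  have "f \<in> {x. \<forall>n. x n = x (Suc n) mod 2 ^ n}"
    by (rule CollectI, rule allI, rule assms)
  then show ?thesis by (simp only: Abs_Z2_inverse)
qed

lemma res_0 [simp]: "res x 0 = 0"
  using res_mod[of x 0] by simp

instantiation Z2 :: comm_ring_1
begin

lift_definition zero_Z2 :: Z2 is "\<lambda>n. 0" by simp

lift_definition one_Z2 :: Z2 is "\<lambda>n. 1 mod 2 ^ n"
  by (simp only: mod_pow2_Suc_mod simp_thms)

lift_definition plus_Z2 :: "Z2 \<Rightarrow> Z2 \<Rightarrow> Z2" is "\<lambda>x y n. (x n + y n) mod 2 ^ n"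
  by (simp (no_asm) only: mod_pow2_Suc_mod) (metis mod_add_eq)

lift_definition times_Z2 :: "Z2 \<Rightarrow> Z2 \<Rightarrow> Z2" is "\<lambda>x y n. (x n * y n) mod 2 ^ n"
  by (simp (no_asm) only: mod_pow2_Suc_mod) (metis mod_mult_eq)

lift_definition uminus_Z2 :: "Z2 \<Rightarrow> Z2" is "\<lambda>x n. (- x n) mod 2 ^ n"
  by (simp (no_asm) only: mod_pow2_Suc_mod) (metis mod_minus_eq)

lift_definition minus_Z2 :: "Z2 \<Rightarrow> Z2 \<Rightarrow> Z2" is "\<lambda>x y n. (x n - y n) mod 2 ^ n"
  by (simp (no_asm) only: mod_pow2_Suc_mod) (metis mod_diff_eq)

lemma Z2_eqI: "(\<And>n. res x n = res y n) \<Longrightarrow> x = y"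
  by (simp add: res_inject[symmetric] fun_eq_iff)

lemmas res_simps = zero_Z2.rep_eq one_Z2.rep_eq plus_Z2.rep_eq times_Z2.rep_eq
  uminus_Z2.rep_eq minus_Z2.rep_eq

instance
proof
  fix a b c :: Z2
  show "a * b * c = a * (b * c)"
    by (rule Z2_eqI) (simp add: res_simps mod_simps mult.assoc)
  show "a * b = b * a"
    by (rule Z2_eqI) (simp add: res_simps mult.commute)
  show "1 * a = a"
    by (rule Z2_eqI) (simp add: res_simps mod_simps res_mod)
  show "a + b + c = a + (b + c)"
    by (rule Z2_eqI) (simp add: res_simps mod_simps add.assoc)
  show "a + b = b + a"
    by (rule Z2_eqI) (simp add: res_simps add.commute)
  show "0 + a = a"
    by (rule Z2_eqI) (simp add: res_simps res_mod)
  show "- a + a = 0"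
    by (rule Z2_eqI) (simp add: res_simps mod_simps)
  show "a - b = a + - b"
    by (rule Z2_eqI) (simp add: res_simps mod_simps)
  show "(a + b) * c = a * c + b * c"
    by (rule Z2_eqI) (simp add: res_simps mod_simps distrib_right)
  have "res 0 1 \<noteq> res (1 :: Z2) 1"
    by (simp add: res_simps)
  then show "(0 :: Z2) \<noteq> 1"
    by metis
qed

end

lemma res_of_nat: "res (of_nat a) n = int a mod 2 ^ n"
  by (induction a) (simp_all add: zero_Z2.rep_eq one_Z2.rep_eq plus_Z2.rep_eq mod_simps)

lemma res_of_int: "res (of_int a) n = a mod 2 ^ n"
  by (cases a) (simp_all add: res_of_nat one_Z2.rep_eq uminus_Z2.rep_eq minus_Z2.rep_eq mod_simps)

lemma res_numeral: "res (numeral a) n = numeral a mod 2 ^ n"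
  using res_of_int[of "numeral a"] by simp

text \<open>The 2-adic topology: the cosets of the ideals generated by \<open>2^n\<close> form a base.\<close>

instantiation Z2 :: t2_space
begin

definition open_Z2 :: "Z2 set \<Rightarrow> bool" where
  "open_Z2 U \<longleftrightarrow> (\<forall>x\<in>U. \<exists>n. \<forall>y. res y n = res x n \<longrightarrow> y \<in> U)"

lemma res_eq_mono:
  assumes "res x n = res y n" and "k \<le> n"
  shows "res x k = res y k"
  using assms(2,1) by (induction rule: dec_induct) (metis res_Suc_mod)+

lemma open_res_ball: "open {y. res y n = res x n}"
  unfolding open_Z2_def by (auto intro: exI[of _ n])

instance
proof
  show "open (UNIV :: Z2 set)"
    by (simp add: open_Z2_def)
next
  fix S T :: "Z2 set"
  assume S: "open S" and T: "open T"
  show "open (S \<inter> T)"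
    unfolding open_Z2_def
  proof
    fix x assume x: "x \<in> S \<inter> T"
    obtain n1 where n1: "\<forall>y. res y n1 = res x n1 \<longrightarrow> y \<in> S"
      using x S unfolding open_Z2_def by blast
    obtain n2 where n2: "\<forall>y. res y n2 = res x n2 \<longrightarrow> y \<in> T"
      using x T unfolding open_Z2_def by blast
    show "\<exists>n. \<forall>y. res y n = res x n \<longrightarrow> y \<in> S \<inter> T"
      using n1 n2 by (intro exI[of _ "max n1 n2"]) (meson IntI max.cobounded1 max.cobounded2 res_eq_mono)
  qed
next
  fix K :: "Z2 set set"
  assume "\<forall>S\<in>K. open S"
  then show "open (\<Union>K)"
    unfolding open_Z2_def by (meson UnionE UnionI)
next
  fix x y :: Z2
  assume "x \<noteq> y"
  then obtain n where n: "res x n \<noteq> res y n"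
    using Z2_eqI by blast
  show "\<exists>U V. open U \<and> open V \<and> x \<in> U \<and> y \<in> V \<and> U \<inter> V = {}"
    by (rule exI[of _ "{z. res z n = res x n}"], rule exI[of _ "{z. res z n = res y n}"])
      (use n in \<open>auto intro: open_res_ball\<close>)
qed

end

lemma Z2_tendsto_iff:
  fixes X :: "nat \<Rightarrow> Z2"
  shows "X \<longlonglongrightarrow> y \<longleftrightarrow> (\<forall>n. \<forall>\<^sub>F k in sequentially. res (X k) n = res y n)"
proof
  assume L: "X \<longlonglongrightarrow> y"
  show "\<forall>n. \<forall>\<^sub>F k in sequentially. res (X k) n = res y n"
  proof
    fix n
    show "\<forall>\<^sub>F k in sequentially. res (X k) n = res y n"
      using topological_tendstoD[OF L open_res_ball, of n y] by simp
  qed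
next
  assume E: "\<forall>n. \<forall>\<^sub>F k in sequentially. res (X k) n = res y n"
  show "X \<longlonglongrightarrow> y"
  proof (rule topological_tendstoI)
    fix S assume "open S" "y \<in> S"
    then obtain n where "\<forall>z. res z n = res y n \<longrightarrow> z \<in> S"
      unfolding open_Z2_def by blast
    then show "\<forall>\<^sub>F k in sequentially. X k \<in> S"
      using E by (metis (mono_tags, lifting) eventually_mono)
  qed
qed

lemma res_pow2_mult: "res (2 ^ k * x) n = 2 ^ k * res x n mod 2 ^ n"
proof -
  have "res (2 ^ k) n = 2 ^ k mod 2 ^ n"
    using res_of_int[of "2 ^ k" n] by simp
  then show ?thesis
    by (simp add: times_Z2.rep_eq mod_simps)
qed

lemma res_sum: "res (\<Sum>i\<in>A. f i) n = (\<Sum>i\<in>A. res (f i) n) mod 2 ^ n"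
  by (induction A rule: infinite_finite_induct)
    (simp_all add: zero_Z2.rep_eq plus_Z2.rep_eq mod_simps)

lemma two_dvd_Z2_iff: "2 dvd (x :: Z2) \<longleftrightarrow> even (res x 1)"
proof
  assume "2 dvd x"
  then obtain y where "x = 2 * y" by auto
  then show "even (res x 1)"
    using res_pow2_mult[of 1 y 1] by simp
next
  assume e: "even (res x 1)"
  have ev: "even (res x (Suc n))" for n
  proof (induction n)
    case (Suc n)
    have "res x (Suc (Suc n)) mod 2 ^ Suc n = res x (Suc n)"
      by (rule res_Suc_mod)
    moreover have "even (res x (Suc (Suc n)) mod 2 ^ Suc n) = even (res x (Suc (Suc n)))"
      by (rule dvd_mod_iff) simp
    ultimately show ?case using Suc.IH by simp
  qed (use e in simp)
  define y where "y = Abs_Z2 (\<lambda>n. res x (Suc n) div 2)"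
  have "res y n = res x (Suc n) div 2" for n
  proof -
    have "res x (Suc n) div 2 = res x (Suc (Suc n)) div 2 mod 2 ^ n" for n
    proof -
      obtain c where c: "res x (Suc (Suc n)) = 2 * c"
        using ev[of "Suc n"] by (elim evenE)
      have "res x (Suc n) = (2 * c) mod (2 * 2 ^ n)"
        using res_Suc_mod[of x "Suc n"] c by simp
      also have "\<dots> = 2 * (c mod 2 ^ n)"
        by (rule mod_mult_mult1)
      finally show ?thesis using c by simp
    qed
    then show ?thesis
      unfolding y_def by (rule res_Abs_Z2)
  qed
  then have "res (2 * y) n = res x n" for n
    using res_pow2_mult[of 1 y n] ev[of n] res_Suc_mod[of x n] by simp
  then show "2 dvd x"
    by (metis Z2_eqI dvd_triv_left)
qed

lemma Z2_add_cases: "(2 :: Z2) dvd x + y \<longleftrightarrow> (2 dvd x \<longleftrightarrow> 2 dvd y)"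
  by (simp add: two_dvd_Z2_iff plus_Z2.rep_eq mod2_eq_if)

lemma Z2_two_dvd_of_int: "(2 :: Z2) dvd of_int a \<longleftrightarrow> even a"
  by (simp add: two_dvd_Z2_iff res_of_int mod2_eq_if)

lemma Z2_two_dvd_mult: "(2 :: Z2) dvd x * y \<longleftrightarrow> 2 dvd x \<or> 2 dvd y"
  by (simp add: two_dvd_Z2_iff times_Z2.rep_eq mod2_eq_if)

lemma Z2_mult_2_cancel:
  fixes x y :: Z2
  assumes "2 * x = 2 * y"
  shows "x = y"
proof (rule Z2_eqI)
  fix n
  have "2 * res x (Suc n) mod 2 ^ Suc n = 2 * res y (Suc n) mod 2 ^ Suc n"
    using assms res_pow2_mult[of 1 x "Suc n"] res_pow2_mult[of 1 y "Suc n"] by simp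
  then have "res x (Suc n) mod 2 ^ n = res y (Suc n) mod 2 ^ n"
    by simp
  then show "res x n = res y n"
    by (simp add: res_Suc_mod)
qed

section \<open>Rational numbers with odd denominator\<close>

definition odd_rats :: "rat set" where
  "odd_rats = {q. odd (snd (quotient_of q))}"

definition Z2_of_rat :: "rat \<Rightarrow> Z2" where
  "Z2_of_rat q = (THE y. of_int (snd (quotient_of q)) * y = of_int (fst (quotient_of q)))"

lemma odd_mult_Z2_ex1:
  assumes "odd d"
  shows "\<exists>!y. of_int d * y = (z :: Z2)"
proof -
  have ex1: "\<exists>!u. u mod 2 ^ n = u \<and> d * u mod 2 ^ n = res z n" for n
  proof -
    have cop: "coprime d (2 ^ n)" using assms by simp
    then obtain e where e: "(d * e) mod 2 ^ n = 1 mod 2 ^ n"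
      by (metis bezout_int coprime_iff_gcd_eq_1 mod_mult_self1 mult.commute add.commute)
    show ?thesis
    proof (rule ex1I[of _ "(e * res z n) mod 2 ^ n"])
      have "d * (e * res z n) mod 2 ^ n = (d * e) mod 2 ^ n * res z n mod 2 ^ n"
        by (simp add: mod_simps mult.assoc)
      also have "\<dots> = res z n"
        unfolding e by (simp add: mod_simps res_mod)
      finally show "(e * res z n) mod 2 ^ n mod 2 ^ n = (e * res z n) mod 2 ^ n \<and>
          d * ((e * res z n) mod 2 ^ n) mod 2 ^ n = res z n"
        by (simp add: mod_simps)
    next
      fix u assume u: "u mod 2 ^ n = u \<and> d * u mod 2 ^ n = res z n"
      have "(e * res z n) mod 2 ^ n = e * (d * u) mod 2 ^ n"
        using u by (metis mod_mult_right_eq)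
      also have "\<dots> = (d * e) mod 2 ^ n * u mod 2 ^ n"
        by (simp add: mod_simps ac_simps)
      also have "\<dots> = u mod 2 ^ n" unfolding e by (simp add: mod_simps)
      also have "\<dots> = u" using u by blast
      finally show "u = (e * res z n) mod 2 ^ n" by simp
    qed
  qed
  then obtain f where f: "\<And>n. f n mod 2 ^ n = f n" "\<And>n. d * f n mod 2 ^ n = res z n"
    by metis
  have coh: "f n = f (Suc n) mod 2 ^ n" for n
  proof -
    have "d * (f (Suc n) mod 2 ^ n) mod 2 ^ n = d * f (Suc n) mod 2 ^ Suc n mod 2 ^ n"
      by (simp only: mod_pow2_Suc_mod mod_mult_right_eq)
    also have "\<dots> = res z n" by (simp only: f(2) res_Suc_mod)
    finally show ?thesis using ex1[of n] f by (metis mod_mod_trivial)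
  qed
  have res_f: "res (Abs_Z2 f) n = f n" for n
    by (rule res_Abs_Z2) (rule coh)
  show ?thesis
  proof (rule ex1I[of _ "Abs_Z2 f"])
    show "of_int d * Abs_Z2 f = z"
      by (rule Z2_eqI) (simp add: times_Z2.rep_eq res_of_int res_f mod_simps f(2))
  next
    fix y assume y: "of_int d * y = z"
    show "y = Abs_Z2 f"
    proof (rule Z2_eqI)
      fix n
      have "d * res y n mod 2 ^ n = res z n"
        using y by (metis mod_mult_left_eq res_of_int times_Z2.rep_eq)
      then show "res y n = res (Abs_Z2 f) n"
        using ex1[of n] f res_f res_mod by metis
    qed
  qed
qed

lemma Z2_of_rat_mult:
  assumes "q \<in> odd_rats"
  shows "of_int (snd (quotient_of q)) * Z2_of_rat q = of_int (fst (quotient_of q))"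
  unfolding Z2_of_rat_def
  by (rule theI') (use assms odd_mult_Z2_ex1 in \<open>auto simp: odd_rats_def\<close>)

lemma of_int_Z2_inject: "of_int a = (of_int b :: Z2) \<longleftrightarrow> a = b"
proof
  assume "of_int a = (of_int b :: Z2)"
  then have E: "a mod 2 ^ n = b mod 2 ^ n" for n by (metis res_of_int)
  define n where "n = nat \<bar>a - b\<bar>"
  have "(2 ^ n :: int) dvd a - b" using E[of n] by (simp add: mod_eq_dvd_iff)
  moreover have "\<bar>a - b\<bar> < 2 ^ n"
    unfolding n_def using of_nat_less_two_power[of "nat \<bar>a - b\<bar>", where 'a = int] by simp
  ultimately show "a = b" using zdvd_imp_le[of "2 ^ n" "\<bar>a - b\<bar>"] by fastforce
qed simp

lemma inj_on_Z2_of_rat: "inj_on Z2_of_rat odd_rats"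
proof (rule inj_onI)
  fix p q assume p: "p \<in> odd_rats" and q: "q \<in> odd_rats" and eq: "Z2_of_rat p = Z2_of_rat q"
  obtain a b where ab: "quotient_of p = (a, b)" by fastforce
  obtain c d where cd: "quotient_of q = (c, d)" by fastforce
  have "of_int (d * a) = (of_int d * (of_int b * Z2_of_rat p) :: Z2)"
    using Z2_of_rat_mult[OF p] ab by simp
  also have "\<dots> = of_int b * (of_int d * Z2_of_rat q)"
    by (simp add: eq ac_simps)
  also have "\<dots> = of_int (b * c)"
    using Z2_of_rat_mult[OF q] cd by simp
  finally have "d * a = b * c" by (simp only: of_int_Z2_inject)
  then have "rat_of_int d * of_int a = of_int b * of_int c"
    by (metis of_int_mult)
  moreover have "b > 0" "d > 0"
    using ab cd quotient_of_denom_pos by blast+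
  moreover have "p = of_int a / of_int b" "q = of_int c / of_int d"
    using ab cd quotient_of_div by blast+
  ultimately show "p = q" by (simp add: frac_eq_eq ac_simps)
qed

text \<open>The 2-adic integers that are rational, and their value as a real number
  (unspecified on other arguments).\<close>

definition Z2_rats :: "Z2 set" where
  "Z2_rats = Z2_of_rat ` odd_rats"

definition real_of_Z2 :: "Z2 \<Rightarrow> real" where
  "real_of_Z2 y = of_rat (the_inv_into odd_rats Z2_of_rat y)"

lemma Z2_rats_iff: "z \<in> Z2_rats \<longleftrightarrow> (\<exists>a d. odd d \<and> of_int d * z = of_int a)"
proof
  assume "z \<in> Z2_rats"
  then obtain q where "q \<in> odd_rats" "z = Z2_of_rat q"
    by (auto simp: Z2_rats_def)
  then show "\<exists>a d. odd d \<and> of_int d * z = of_int a"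
    using Z2_of_rat_mult[of q] unfolding odd_rats_def by blast
next
  assume "\<exists>a d. odd d \<and> of_int d * z = of_int a"
  then obtain a d where d: "odd d" and z: "of_int d * z = of_int a" by blast
  define q where "q = Fract a d"
  obtain b c where bc: "quotient_of q = (b, c)" by fastforce
  have c: "c > 0" "q = of_int b / of_int c" "coprime b c"
    using bc quotient_of_denom_pos quotient_of_div quotient_of_coprime by blast+
  have "rat_of_int a / of_int d = of_int b / of_int c"
    using c(2) by (simp add: q_def Fract_of_int_quotient)
  moreover have "d \<noteq> 0" using d by auto
  ultimately have "rat_of_int (a * c) = of_int (b * d)"
    using c(1) by (simp add: frac_eq_eq)
  then have ac: "a * c = b * d" by (simp only: of_int_eq_iff)
  have "c dvd b * d" using ac by (metis dvd_triv_right)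
  then have "c dvd d" using c(3) by (simp add: coprime_commute coprime_dvd_mult_right_iff)
  then have oc: "odd c" using d dvd_trans by blast
  have q: "q \<in> odd_rats" using oc bc by (simp add: odd_rats_def)
  have "of_int d * (of_int c * z) = (of_int c * (of_int d * z) :: Z2)"
    by (simp add: ac_simps)
  also have "\<dots> = of_int (a * c)"
    unfolding z by (simp add: ac_simps)
  also have "\<dots> = of_int d * of_int b"
    by (simp add: ac ac_simps)
  finally have "of_int c * z = of_int b"
    using odd_mult_Z2_ex1[OF d] by blast
  moreover have "of_int c * Z2_of_rat q = of_int b"
    using Z2_of_rat_mult[OF q] bc by simp
  ultimately have "z = Z2_of_rat q"
    using odd_mult_Z2_ex1[OF oc] by blast
  then show "z \<in> Z2_rats" using q by (simp add: Z2_rats_def)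
qed

section \<open>The generalized Collatz map and its autoconjugacy\<close>

definition T :: "int \<Rightarrow> int \<Rightarrow> Z2 \<Rightarrow> Z2" where
  "T m r x = (THE y. 2 * y = (if 2 dvd x then x else of_int m * x + of_int r))"

lemma T_mult_2:
  assumes "odd m" "odd r"
  shows "2 * T m r x = (if 2 dvd x then x else of_int m * x + of_int r)"
proof -
  have "2 dvd (if 2 dvd x then x else of_int m * x + of_int r)"
  proof (cases "2 dvd x")
    case False
    then show ?thesis using assms
      by (simp add: Z2_add_cases Z2_two_dvd_mult Z2_two_dvd_of_int)
  qed simp
  then obtain y where y: "(if 2 dvd x then x else of_int m * x + of_int r) = 2 * y"
    by (elim dvdE)
  have "\<exists>!y. 2 * y = (if 2 dvd x then x else of_int m * x + of_int r)"
    unfolding y by (rule ex1I[of _ y]) (auto dest: Z2_mult_2_cancel)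
  then show ?thesis unfolding T_def by (rule theI')
qed

definition digit :: "int \<Rightarrow> int \<Rightarrow> Z2 \<Rightarrow> nat \<Rightarrow> nat" where
  "digit m r x k = (if 2 dvd (T m r ^^ k) x then 0 else 1)"

definition Q :: "int \<Rightarrow> int \<Rightarrow> Z2 \<Rightarrow> Z2" where
  "Q m r x = (\<Sum>k. of_nat (digit m r x k) * 2 ^ k)"

definition Q_trunc :: "nat \<Rightarrow> int \<Rightarrow> int \<Rightarrow> Z2 \<Rightarrow> nat" where
  "Q_trunc k m r x = (\<Sum>i<k. digit m r x i * 2 ^ i)"

lemma Q_trunc_0 [simp]: "Q_trunc 0 m r x = 0"
  by (simp add: Q_trunc_def)

lemma Q_trunc_Suc: "Q_trunc (Suc n) m r x = digit m r x 0 + 2 * Q_trunc n m r (T m r x)"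
proof -
  have "digit m r x (Suc i) = digit m r (T m r x) i" for i
    by (simp only: digit_def funpow_Suc_right comp_apply)
  then show ?thesis
    unfolding Q_trunc_def
    by (simp add: sum.lessThan_Suc_shift sum_distrib_left ac_simps del: sum.lessThan_Suc)
qed

lemma Q_trunc_less: "Q_trunc n m r x < 2 ^ n"
proof (induction n arbitrary: x)
  case (Suc n)
  have "digit m r x 0 \<le> 1" by (simp add: digit_def)
  then show ?case using Suc.IH[of "T m r x"] by (simp add: Q_trunc_Suc)
qed simp

lemma res_Q: "res (Q m r x) n = int (Q_trunc n m r x)"
proof -
  have Suc: "Q_trunc (Suc n) m r x = Q_trunc n m r x + digit m r x n * 2 ^ n" for n
    by (simp add: Q_trunc_def)
  define y where "y = Abs_Z2 (\<lambda>n. int (Q_trunc n m r x))"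
  have res_y: "res y n = int (Q_trunc n m r x)" for n
  proof -
    have "int (Q_trunc n m r x) = int (Q_trunc (Suc n) m r x) mod 2 ^ n" for n
      using Q_trunc_less[of n m r x]
      by (simp only: Suc) (simp add: of_nat_less_numeral_power_cancel_iff)
    then show ?thesis
      unfolding y_def by (rule res_Abs_Z2)
  qed
  have coh: "int (Q_trunc k m r x) mod 2 ^ n = res y n" if "n \<le> k" for n k
    using that
  proof (induction rule: dec_induct)
    case base
    then show ?case by (metis res_mod res_y)
  next
    case (step j)
    have "(2 ^ n :: int) dvd 2 ^ j" using step by (simp add: le_imp_power_dvd)
    then have "int (Q_trunc (Suc j) m r x) mod 2 ^ n = int (Q_trunc j m r x) mod 2 ^ n"
      by (simp only: Suc mod_eq_dvd_iff) simp
    then show ?case using step by simp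
  qed
  have "(\<lambda>k. of_nat (digit m r x k) * 2 ^ k) sums y"
    unfolding sums_def Z2_tendsto_iff
  proof
    fix n
    have "(\<Sum>i<k. of_nat (digit m r x i) * 2 ^ i) = (of_nat (Q_trunc k m r x) :: Z2)" for k
      by (simp add: Q_trunc_def)
    then show "\<forall>\<^sub>F k in sequentially. res (\<Sum>i<k. of_nat (digit m r x i) * 2 ^ i) n = res y n"
      unfolding eventually_sequentially by (intro exI[of _ n]) (simp add: res_of_nat coh)
  qed
  then have "Q m r x = y"
    unfolding Q_def by (simp add: sums_iff)
  then show ?thesis by (simp add: res_y)
qed

lemma Q_rec: "Q m r x = of_nat (digit m r x 0) + 2 * Q m r (T m r x)"
proof (rule Z2_eqI)
  fix n
  show "res (Q m r x) n = res (of_nat (digit m r x 0) + 2 * Q m r (T m r x)) n"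
  proof (cases n)
    case (Suc k)
    have "res (Q m r (T m r x)) (Suc k) mod 2 ^ k = int (Q_trunc k m r (T m r x))"
      unfolding res_Suc_mod by (rule res_Q)
    then have "2 * res (Q m r (T m r x)) (Suc k) mod 2 ^ Suc k = 2 * int (Q_trunc k m r (T m r x))"
      by (simp only: power_Suc mod_mult_mult1)
    then have "res (of_nat (digit m r x 0) + 2 * Q m r (T m r x)) (Suc k)
        = int (Q_trunc (Suc k) m r x) mod 2 ^ Suc k"
      using res_pow2_mult[of 1 "Q m r (T m r x)" "Suc k"]
      by (simp only: plus_Z2.rep_eq res_of_nat mod_add_left_eq Q_trunc_Suc of_nat_add of_nat_mult
          of_nat_numeral power_one_right)
    also have "\<dots> = res (Q m r x) (Suc k)"
      by (metis res_Q res_mod)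
    finally show ?thesis using Suc by simp
  qed simp
qed

lemma T_eqI:
  assumes "if 2 dvd x then x = 2 * y else of_int m * x + of_int r = 2 * y"
  shows "T m r x = y"
  unfolding T_def using assms by (intro the_equality) (auto split: if_splits dest: Z2_mult_2_cancel)

lemma res_mult_2_Suc: "res (2 * x) (Suc n) = 2 * res x n"
proof -
  have "res (2 * x) (Suc n) = 2 * res x (Suc n) mod (2 * 2 ^ n)"
    using res_pow2_mult[of 1 x "Suc n"] by simp
  also have "\<dots> = 2 * (res x (Suc n) mod 2 ^ n)"
    by (rule mod_mult_mult1)
  finally show ?thesis by (simp add: res_Suc_mod)
qed

lemma Q_trunc_eq_iff:
  assumes "odd m" "odd r"
  shows "Q_trunc n m r x = Q_trunc n m r y \<longleftrightarrow> res x n = res y n"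
proof (induction n arbitrary: x y)
  case (Suc n)
  have parity: "res x (Suc n) \<noteq> res y (Suc n)" if "(2 dvd x) \<noteq> (2 dvd y)" for x y
    using that res_eq_mono[of x "Suc n" y 1] by (auto simp: two_dvd_Z2_iff)
  have iff: "res (T m r x) n = res (T m r y) n \<longleftrightarrow> res x (Suc n) = res y (Suc n)"
    if d: "2 dvd x \<longleftrightarrow> 2 dvd y"
  proof (cases "2 dvd x")
    case True
    then show ?thesis
      using d T_mult_2[OF assms, of x] T_mult_2[OF assms, of y]
        res_mult_2_Suc[of "T m r x" n] res_mult_2_Suc[of "T m r y" n] by simp
  next
    case False
    have *: "2 * res (T m r z) n = (m * res z (Suc n) + r) mod 2 ^ Suc n" if "\<not> 2 dvd z" for z
      using that T_mult_2[OF assms, of z] res_mult_2_Suc[of "T m r z" n]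
      by (simp add: plus_Z2.rep_eq times_Z2.rep_eq res_of_int mod_simps del: power_Suc)
    have "res (T m r x) n = res (T m r y) n \<longleftrightarrow>
        (m * res x (Suc n) + r) mod 2 ^ Suc n = (m * res y (Suc n) + r) mod 2 ^ Suc n"
      using *[of x] *[of y] False d by linarith
    also have "\<dots> \<longleftrightarrow> 2 ^ Suc n dvd m * (res x (Suc n) - res y (Suc n))"
      by (simp add: mod_eq_dvd_iff algebra_simps del: power_Suc)
    also have "\<dots> \<longleftrightarrow> 2 ^ Suc n dvd res x (Suc n) - res y (Suc n)"
      using assms(1) by (intro coprime_dvd_mult_right_iff) simp
    also have "\<dots> \<longleftrightarrow> res x (Suc n) mod 2 ^ Suc n = res y (Suc n) mod 2 ^ Suc n"
      by (simp only: mod_eq_dvd_iff)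
    also have "\<dots> \<longleftrightarrow> res x (Suc n) = res y (Suc n)"
      by (simp only: res_mod)
    finally show ?thesis .
  qed
  show ?case
  proof (cases "2 dvd x \<longleftrightarrow> 2 dvd y")
    case True
    then show ?thesis
      using iff Suc.IH[of "T m r x" "T m r y"] by (simp add: Q_trunc_Suc digit_def)
  next
    case False
    then have "Q_trunc (Suc n) m r x \<noteq> Q_trunc (Suc n) m r y"
      by (cases "2 dvd x"; simp add: Q_trunc_Suc digit_def; presburger)
    then show ?thesis using parity[OF False] by simp
  qed
qed simp

lemma Q_trunc_surj:
  assumes "odd m" "odd r" "t < 2 ^ n"
  shows "\<exists>x. Q_trunc n m r x = t"
  using assms(3)
proof (induction n arbitrary: t)
  case (Suc n)
  then obtain z where z: "Q_trunc n m r z = t div 2"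
    by (metis less_mult_imp_div_less mult.commute power_Suc)
  show ?case
  proof (cases "even t")
    case True
    have "T m r (2 * z) = z" by (rule T_eqI) simp
    then have "Q_trunc (Suc n) m r (2 * z) = t"
      using True z by (simp add: Q_trunc_Suc digit_def)
    then show ?thesis by blast
  next
    case False
    obtain x where x: "of_int m * x = 2 * z - of_int r"
      using odd_mult_Z2_ex1[OF assms(1)] by blast
    have "of_int m * x + of_int r = 2 * z" using x by simp
    moreover from this have "\<not> 2 dvd x"
      using assms(1,2) Z2_add_cases[of "of_int m * x" "of_int r"]
      by (auto simp: Z2_two_dvd_mult Z2_two_dvd_of_int)
    ultimately have "T m r x = z" "digit m r x 0 = 1"
      by (auto intro!: T_eqI simp: digit_def)
    then have "Q_trunc (Suc n) m r x = t"
      using False z by (simp add: Q_trunc_Suc)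
    then show ?thesis by blast
  qed
qed simp

lemma bij_Q:
  assumes "odd m" "odd r"
  shows "bij (Q m r)"
proof (rule bijI)
  show "inj (Q m r)"
  proof (rule injI)
    fix x y assume "Q m r x = Q m r y"
    then have "Q_trunc n m r x = Q_trunc n m r y" for n
      by (metis res_Q of_nat_eq_iff)
    then show "x = y"
      using Q_trunc_eq_iff[OF assms] Z2_eqI by blast
  qed
  show "surj (Q m r)"
    unfolding surj_def
  proof
    fix y
    have "\<exists>x. int (Q_trunc n m r x) = res y n" for n
    proof -
      have b: "0 \<le> res y n" "res y n < 2 ^ n"
        using res_mod[of y n] pos_mod_bound[of "2 ^ n" "res y n"] pos_mod_sign[of "2 ^ n" "res y n"]
        by simp_all
      then have "nat (res y n) < 2 ^ n" by (simp add: nat_less_iff)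
      then show ?thesis using Q_trunc_surj[OF assms] b(1) by (metis int_nat_eq)
    qed
    then obtain X where X: "\<And>n. int (Q_trunc n m r (X n)) = res y n" by metis
    have coh: "res (X n) n = res (X (Suc n)) (Suc n) mod 2 ^ n" for n
    proof -
      have "int (Q_trunc n m r (X (Suc n))) = int (Q_trunc (Suc n) m r (X (Suc n))) mod 2 ^ n"
        using res_Suc_mod[of "Q m r (X (Suc n))" n] by (simp only: res_Q)
      also have "\<dots> = int (Q_trunc n m r (X n))"
        by (simp only: X res_Suc_mod)
      finally have "res (X (Suc n)) n = res (X n) n"
        using Q_trunc_eq_iff[OF assms] by simp
      then show ?thesis by (simp only: res_Suc_mod)
    qed
    define x where "x = Abs_Z2 (\<lambda>n. res (X n) n)"
    have "res x n = res (X n) n" for n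
      unfolding x_def by (rule res_Abs_Z2) (rule coh)
    then have "Q_trunc n m r x = Q_trunc n m r (X n)" for n
      using Q_trunc_eq_iff[OF assms] by blast
    then have "y = Q m r x"
      by (intro Z2_eqI) (simp add: res_Q X[symmetric])
    then show "\<exists>x. y = Q m r x" ..
  qed
qed


definition Phi :: "int \<Rightarrow> int \<Rightarrow> Z2 \<Rightarrow> Z2" where
  "Phi m r = inv (Q m r)"

definition V :: "Z2 \<Rightarrow> Z2" where
  "V x = - 1 - x"

definition Omega :: "int \<Rightarrow> int \<Rightarrow> Z2 \<Rightarrow> Z2" where
  "Omega m r = Phi m r \<circ> V \<circ> Q m r"

definition Omega_trunc :: "nat \<Rightarrow> int \<Rightarrow> int \<Rightarrow> Z2 \<Rightarrow> Z2" where
  "Omega_trunc k m r x = Phi m r (V (of_nat (Q_trunc k m r x)))"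

lemma Omega_trunc_rats:
  assumes "odd m" "odd r"
  shows "Omega_trunc k m r x \<in> Z2_rats"
proof -
  have "\<exists>z \<in> Z2_rats. Q m r z = V (of_nat t)" if "t < 2 ^ k" for t
    using that
  proof (induction k arbitrary: t)
    case 0
    have "odd (2 - m)" using assms(1) by simp
    then obtain z where z: "of_int (2 - m) * z = (of_int r :: Z2)"
      using odd_mult_Z2_ex1 by blast
    have fix_eq: "of_int m * z + of_int r = 2 * z"
      unfolding z[symmetric] by (simp add: algebra_simps)
    have "\<not> 2 dvd z"
      using assms z by (metis Z2_two_dvd_mult Z2_two_dvd_of_int)
    then have "T m r z = z" "digit m r z 0 = 1"
      using fix_eq by (auto intro!: T_eqI simp: digit_def)
    then have "Q m r z = 1 + 2 * Q m r z"
      using Q_rec[of m r z] by simp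
    then have "Q m r z = - 1"
      by (metis add.commute add.left_commute add_cancel_right_right mult_2 eq_neg_iff_add_eq_0)
    moreover have "z \<in> Z2_rats"
      unfolding Z2_rats_iff using z \<open>odd (2 - m)\<close> by blast
    ultimately show ?case using 0 by (auto simp: V_def)
  next
    case (Suc k)
    then have "t div 2 < 2 ^ k"
      by (metis less_mult_imp_div_less mult.commute power_Suc)
    then obtain z where z: "z \<in> Z2_rats" "Q m r z = V (of_nat (t div 2))"
      using Suc.IH by blast
    then obtain a d where ad: "odd d" "of_int d * z = of_int a"
      unfolding Z2_rats_iff by blast
    show ?case
    proof (cases "even t")
      case False
      have "T m r (2 * z) = z" by (rule T_eqI) simp
      then have "Q m r (2 * z) = 2 * V (of_nat (t div 2))"
        using Q_rec[of m r "2 * z"] z by (simp add: digit_def)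
      also have "\<dots> = V (of_nat (2 * (t div 2) + 1))"
        by (simp add: V_def algebra_simps)
      also have "2 * (t div 2) + 1 = t" using False by presburger
      finally have "Q m r (2 * z) = V (of_nat t)" .
      moreover have "of_int d * (2 * z) = of_int (2 * a)"
        using ad(2) by (metis mult.left_commute of_int_mult of_int_numeral)
      ultimately show ?thesis using ad unfolding Z2_rats_iff Bex_def by blast
    next
      case True
      obtain y where y: "of_int m * y = 2 * z - of_int r"
        using odd_mult_Z2_ex1[OF assms(1)] by blast
      have my: "of_int m * y + of_int r = 2 * z" using y by simp
      then have "\<not> 2 dvd y"
        using assms(1,2) Z2_add_cases[of "of_int m * y" "of_int r"]
        by (auto simp: Z2_two_dvd_mult Z2_two_dvd_of_int)
      with my have "T m r y = z" "digit m r y 0 = 1"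
        by (auto intro!: T_eqI simp: digit_def)
      then have "Q m r y = 1 + 2 * V (of_nat (t div 2))"
        using Q_rec[of m r y] z by simp
      also have "\<dots> = V (of_nat (2 * (t div 2)))"
        by (simp add: V_def algebra_simps)
      also have "2 * (t div 2) = t" using True by presburger
      finally have "Q m r y = V (of_nat t)" .
      moreover have "of_int (d * m) * y = of_int (2 * a - d * r)"
      proof -
        have "of_int (d * m) * y = of_int d * (of_int m * y)"
          by (simp add: mult.assoc)
        also have "\<dots> = 2 * (of_int d * z) - of_int d * of_int r"
          unfolding y by (simp add: algebra_simps)
        finally show ?thesis using ad by simp
      qed
      moreover have "odd (d * m)" using ad assms by simp
      ultimately show ?thesis unfolding Z2_rats_iff Bex_def by blast
    qed
  qed
  from this[OF Q_trunc_less] obtain z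
    where z: "z \<in> Z2_rats" "Q m r z = V (of_nat (Q_trunc k m r x))" by blast
  then have "Omega_trunc k m r x = z"
    unfolding Omega_trunc_def Phi_def by (metis bij_Q[OF assms] bij_is_inj inv_f_f)
  then show ?thesis using z by simp
qed

text \<open>Existence of this limit is the predicate
  \<open>convergent (\<lambda>k. real_of_Z2 (Omega_trunc k m r x))\<close>.\<close>

definition Omega_hat :: "int \<Rightarrow> int \<Rightarrow> Z2 \<Rightarrow> real" where
  "Omega_hat m r x = lim (\<lambda>k. real_of_Z2 (Omega_trunc k m r x))"

definition nu :: "int \<Rightarrow> int \<Rightarrow> Z2 \<Rightarrow> ereal" where
  "nu m r x = liminf (\<lambda>k. ereal (real (card {i. i < k \<and> 2 dvd (T m r ^^ i) x}) / real k))"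

end

theory Submission
  imports Defs
begin

text \<open>
  Since \<open>V\<close> complements binary digits, \<open>Omega m r x\<close> is the 2-adic integer whose iterates under
  \<open>T\<close> have at every time the parity opposite to that of the iterates of \<open>x\<close>. The truncation
  \<open>Omega_trunc k m r x\<close> does so up to time \<open>k\<close>, and then its iterates are odd forever because
  they sit at the fixed point \<open>c = r / (2 - m)\<close>.

  A point is recovered from its \<open>k\<close>-th iterate and its first \<open>k\<close> parities through inverse
  branches \<open>y \<mapsto> 2 * y\<close> and \<open>y \<mapsto> (2 * y - r) / m\<close>. These formulas hold for the real values of
  rational points too, so there two points with the same first \<open>k\<close> parities differ by
  \<open>2 ^ k / m ^ n\<close> times the difference of their \<open>k\<close>-th iterates, where \<open>n\<close> counts the odd
  steps (\<open>real_of_Z2_diff_funpow_T\<close>). For the points compared here \<open>n\<close> is the number of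
  even iterates of \<open>x\<close> before time \<open>k\<close>, and the hypothesis on \<open>nu\<close> says precisely that this factor
  decays geometrically (\<open>power_card_even_iterates_le\<close>).

  Consecutive truncations share \<open>k\<close> parities and have \<open>k\<close>-th iterates in a bounded set, so their
  differences are summable: the limit exists. If \<open>Q m r x\<close> is rational, then so is \<open>Q\<close> at
  \<open>Omega m r x\<close>, whence the orbit of \<open>Omega m r x\<close> is finite (\<open>finite_orbit_if_Q_rat\<close>); a finite
  orbit consists of rational points (\<open>finite_orbit_Z2_rats\<close>) and, being finite, is bounded in the
  reals. Comparing \<open>Omega_trunc k m r x\<close> directly with \<open>Omega m r x\<close> then identifies the limit.
\<close>

section \<open>Rational 2-adic integers as real numbers\<close>

lemma real_of_Z2_fraction:
  assumes "odd d" and "of_int d * z = (of_int a :: Z2)"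
  shows "real_of_Z2 z = real_of_int a / real_of_int d"
proof -
  have "z \<in> Z2_rats"
    using assms Z2_rats_iff by blast
  then obtain q where q: "q \<in> odd_rats" "z = Z2_of_rat q"
    by (auto simp: Z2_rats_def)
  obtain b c where bc: "quotient_of q = (b, c)" by fastforce
  have c: "c > 0" "q = of_int b / of_int c"
    using bc quotient_of_denom_pos quotient_of_div by blast+
  have "of_int c * z = of_int b"
    using Z2_of_rat_mult[OF q(1)] bc q(2) by simp
  then have "(of_int (d * b) :: Z2) = of_int c * (of_int d * z)"
    by (metis mult.left_commute of_int_mult)
  also have "\<dots> = of_int (c * a)"
    by (simp add: assms(2))
  finally have "real_of_int (d * b) = real_of_int (c * a)"
    by (simp only: of_int_Z2_inject)
  moreover have "d \<noteq> 0" using assms(1) by auto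
  ultimately have "real_of_int b / of_int c = of_int a / of_int d"
    using c(1) by (simp add: frac_eq_eq ac_simps)
  moreover have "real_of_Z2 z = of_rat q"
    by (simp add: real_of_Z2_def q the_inv_into_f_f[OF inj_on_Z2_of_rat])
  ultimately show ?thesis
    by (simp add: c(2) of_rat_divide)
qed

lemma Z2_rats_affine:
  assumes "z \<in> Z2_rats"
  shows "of_int a * z + of_int b \<in> Z2_rats"
    and "real_of_Z2 (of_int a * z + of_int b) = of_int a * real_of_Z2 z + of_int b"
proof -
  obtain e d where d: "odd d" "of_int d * z = of_int e"
    using assms Z2_rats_iff by blast
  have "of_int d * (of_int a * z + of_int b) = of_int a * (of_int d * z) + of_int (d * b)"
    by (simp add: algebra_simps)
  then have eq: "of_int d * (of_int a * z + of_int b) = (of_int (a * e + d * b) :: Z2)"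
    by (simp add: d(2))
  then show "of_int a * z + of_int b \<in> Z2_rats"
    using d(1) Z2_rats_iff by blast
  have "d \<noteq> 0" using d(1) by auto
  then show "real_of_Z2 (of_int a * z + of_int b) = of_int a * real_of_Z2 z + of_int b"
    unfolding real_of_Z2_fraction[OF d(1) eq] real_of_Z2_fraction[OF d]
    by (simp add: field_simps)
qed

lemma Z2_rats_cancel_odd:
  assumes "odd c" and "of_int c * z \<in> Z2_rats"
  shows "z \<in> Z2_rats"
proof -
  obtain a d where d: "odd d" "of_int d * (of_int c * z) = of_int a"
    using assms(2) Z2_rats_iff by blast
  have "odd (d * c)" "of_int (d * c) * z = of_int a"
    using d assms(1) by (simp_all add: mult.assoc)
  then show ?thesis using Z2_rats_iff by blast
qed

lemma Z2_rats_cancel_2: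
  assumes "2 * z \<in> Z2_rats"
  shows "z \<in> Z2_rats"
proof -
  obtain a d where d: "odd d" "of_int d * (2 * z) = of_int a"
    using assms Z2_rats_iff by blast
  have "2 dvd (of_int a :: Z2)"
    by (simp add: d(2)[symmetric])
  then obtain b where b: "a = 2 * b"
    using Z2_two_dvd_of_int by (auto elim: evenE)
  have "2 * (of_int d * z) = 2 * of_int b"
    using d(2) by (simp add: b ac_simps)
  then show ?thesis
    using d(1) Z2_mult_2_cancel Z2_rats_iff by blast
qed

section \<open>The Collatz map on rational points\<close>

lemma T_Z2_rats:
  assumes "odd m" "odd r" "z \<in> Z2_rats"
  shows "T m r z \<in> Z2_rats"
  using Z2_rats_cancel_2 T_mult_2[OF assms(1,2), of z] Z2_rats_affine(1)[OF assms(3)] assms(3)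
  by metis

lemma funpow_T_Z2_rats:
  assumes "odd m" "odd r" "z \<in> Z2_rats"
  shows "(T m r ^^ k) z \<in> Z2_rats"
  by (induction k) (use assms T_Z2_rats in auto)

lemma real_of_Z2_T:
  assumes "odd m" "odd r" "z \<in> Z2_rats"
  shows "2 * real_of_Z2 (T m r z)
    = (if 2 dvd z then real_of_Z2 z else of_int m * real_of_Z2 z + of_int r)"
proof -
  have "real_of_Z2 (2 * T m r z) = 2 * real_of_Z2 (T m r z)"
    using Z2_rats_affine(2)[OF T_Z2_rats[OF assms], of 2 0] by simp
  then show ?thesis
    unfolding T_mult_2[OF assms(1,2)] using Z2_rats_affine(2)[OF assms(3), of m r]
    by (simp split: if_splits)
qed

text \<open>Along a fixed sequence of parities the inverse branches of \<open>T\<close> are affine, with slope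
  \<open>2\<close> at an even and \<open>2 / m\<close> at an odd iterate, so the distance of two points sharing these
  parities is the product of the slopes times the distance of their \<open>k\<close>-th iterates. The parities
  are prescribed as the opposites of those of \<open>x\<close>, because this is what \<open>Omega\<close> produces: the
  contracting steps are then counted by the even iterates of \<open>x\<close>.\<close>

lemma real_of_Z2_diff_funpow_T:
  assumes "odd m" "odd r" "z \<in> Z2_rats" "w \<in> Z2_rats"
    and "\<And>i. i < k \<Longrightarrow> 2 dvd (T m r ^^ i) z \<longleftrightarrow> \<not> 2 dvd (T m r ^^ i) x"
    and "\<And>i. i < k \<Longrightarrow> 2 dvd (T m r ^^ i) w \<longleftrightarrow> \<not> 2 dvd (T m r ^^ i) x"
  shows "real_of_Z2 z - real_of_Z2 w
    = 2 ^ k / of_int m ^ card {i. i < k \<and> 2 dvd (T m r ^^ i) x}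
      * (real_of_Z2 ((T m r ^^ k) z) - real_of_Z2 ((T m r ^^ k) w))"
  using assms(5,6)
proof (induction k)
  case (Suc k)
  have m: "real_of_int m \<noteq> 0" using assms(1) by auto
  let ?z = "(T m r ^^ k) z" and ?w = "(T m r ^^ k) w"
  have par: "2 dvd ?z \<longleftrightarrow> \<not> 2 dvd (T m r ^^ k) x" "2 dvd ?w \<longleftrightarrow> \<not> 2 dvd (T m r ^^ k) x"
    using Suc.prems by auto
  note step = real_of_Z2_T[OF assms(1,2) funpow_T_Z2_rats[OF assms(1,2,3)], of k]
    real_of_Z2_T[OF assms(1,2) funpow_T_Z2_rats[OF assms(1,2,4)], of k]
  have IH: "real_of_Z2 z - real_of_Z2 w
    = 2 ^ k / of_int m ^ card {i. i < k \<and> 2 dvd (T m r ^^ i) x} * (real_of_Z2 ?z - real_of_Z2 ?w)"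
    by (rule Suc.IH) (use Suc.prems in auto)
  show ?case
  proof (cases "2 dvd (T m r ^^ k) x")
    case True
    have "{i. i < Suc k \<and> 2 dvd (T m r ^^ i) x} = insert k {i. i < k \<and> 2 dvd (T m r ^^ i) x}"
      using True by (auto simp: less_Suc_eq)
    then have card: "card {i. i < Suc k \<and> 2 dvd (T m r ^^ i) x}
        = Suc (card {i. i < k \<and> 2 dvd (T m r ^^ i) x})"
      by simp
    have "of_int m * (real_of_Z2 ?z - real_of_Z2 ?w)
        = 2 * (real_of_Z2 (T m r ?z) - real_of_Z2 (T m r ?w))"
      using step par True by (simp add: algebra_simps)
    then have eq: "real_of_Z2 ?z - real_of_Z2 ?w
        = 2 / of_int m * (real_of_Z2 (T m r ?z) - real_of_Z2 (T m r ?w))"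
      using m by (simp add: field_simps)
    show ?thesis
      unfolding IH card eq by (simp add: ac_simps)
  next
    case False
    then have "{i. i < Suc k \<and> 2 dvd (T m r ^^ i) x} = {i. i < k \<and> 2 dvd (T m r ^^ i) x}"
      by (auto simp: less_Suc_eq)
    moreover have "real_of_Z2 ?z - real_of_Z2 ?w
        = 2 * (real_of_Z2 (T m r ?z) - real_of_Z2 (T m r ?w))"
      using step par False by (simp add: algebra_simps)
    ultimately show ?thesis
      unfolding IH by simp
  qed
qed simp

text \<open>The forward form, free of denominators, so that it makes sense at every 2-adic integer.\<close>

lemma pow2_mult_funpow_T:
  assumes "odd m" "odd r"
  shows "\<exists>n b. 2 ^ k * (T m r ^^ k) z = of_int (m ^ n) * z + of_int b"
proof (induction k)
  case 0
  show ?case by (rule exI[of _ 0], rule exI[of _ 0]) simp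
next
  case (Suc k)
  then obtain n b where nb: "2 ^ k * (T m r ^^ k) z = of_int (m ^ n) * z + of_int b" by blast
  let ?y = "(T m r ^^ k) z"
  have "2 ^ Suc k * (T m r ^^ Suc k) z = 2 ^ k * (2 * T m r ?y)"
    by (simp add: ac_simps)
  also have "\<dots> = (if 2 dvd ?y then 2 ^ k * ?y else of_int m * (2 ^ k * ?y) + 2 ^ k * of_int r)"
    by (simp add: T_mult_2[OF assms] algebra_simps)
  finally have eq: "2 ^ Suc k * (T m r ^^ Suc k) z = \<dots>" .
  show ?case
  proof (cases "2 dvd ?y")
    case True
    then show ?thesis using eq nb by auto
  next
    case False
    then have "2 ^ Suc k * (T m r ^^ Suc k) z
        = of_int (m ^ Suc n) * z + of_int (m * b + 2 ^ k * r)"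
      using eq nb by (simp add: algebra_simps)
    then show ?thesis by blast
  qed
qed

text \<open>A point with finite orbit repeats a value \<open>y\<close>, and the affine relation of the period \<open>p\<close>
  reads \<open>(2 ^ p - m ^ n) * y = b\<close> with an odd coefficient; so \<open>y\<close> is rational, and \<open>z\<close> with it.\<close>

lemma finite_orbit_Z2_rats:
  assumes "odd m" "odd r" and "finite (range (\<lambda>k. (T m r ^^ k) z))"
  shows "z \<in> Z2_rats"
proof -
  have "\<not> inj (\<lambda>k. (T m r ^^ k) z)"
    using assms(3) finite_imageD infinite_UNIV_nat by blast
  then obtain i j where ij: "(T m r ^^ i) z = (T m r ^^ j) z" "i < j"
    unfolding inj_def by (metis linorder_neqE_nat)
  define y where "y = (T m r ^^ i) z"
  define p where "p = j - i"
  have "j = p + i" using ij(2) by (simp add: p_def)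
  then have per: "(T m r ^^ p) y = y"
    using ij(1) by (simp add: y_def funpow_add)
  obtain n b where "2 ^ p * (T m r ^^ p) y = of_int (m ^ n) * y + of_int b"
    using pow2_mult_funpow_T[OF assms(1,2)] by blast
  then have "of_int (2 ^ p - m ^ n) * y = of_int b"
    by (simp add: per algebra_simps)
  moreover have "odd (2 ^ p - m ^ n)"
    using assms(1) ij(2) by (simp add: p_def)
  ultimately have y: "y \<in> Z2_rats"
    using Z2_rats_iff by blast
  obtain n' b' where "2 ^ i * y = of_int (m ^ n') * z + of_int b'"
    using pow2_mult_funpow_T[OF assms(1,2), of i z] by (auto simp: y_def)
  then have "of_int (m ^ n') * z = of_int (2 ^ i) * y + of_int (- b')"
    by simp
  then have "of_int (m ^ n') * z \<in> Z2_rats"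
    using Z2_rats_affine(1)[OF y] by metis
  then show ?thesis
    using Z2_rats_cancel_odd[of "m ^ n'"] assms(1) by simp
qed

text \<open>If \<open>Q z\<close> has denominator \<open>d\<close>, then so have all its shifts \<open>Q (T z), Q (T (T z)), \<dots>\<close>, and
  their numerators stay bounded since each is half of the previous one minus \<open>0\<close> or \<open>d\<close>.
  Only finitely many values are possible, and \<open>Q\<close> is injective.\<close>

lemma finite_orbit_if_Q_rat:
  assumes "odd m" "odd r" and "Q m r z \<in> Z2_rats"
  shows "finite (range (\<lambda>k. (T m r ^^ k) z))"
proof -
  obtain a d where d: "odd d" "of_int d * Q m r z = of_int a"
    using assms(3) Z2_rats_iff by blast
  define B where "B = max \<bar>a\<bar> \<bar>d\<bar>"
  have num: "\<exists>a'\<in>{-B..B}. of_int d * Q m r ((T m r ^^ k) z) = of_int a'" for k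
  proof (induction k)
    case 0
    show ?case using d(2) by (intro bexI[of _ a]) (auto simp: B_def)
  next
    case (Suc k)
    let ?y = "(T m r ^^ k) z"
    obtain a' where a': "a' \<in> {-B..B}" "of_int d * Q m r ?y = of_int a'"
      using Suc by blast
    define e where "e = int (digit m r ?y 0)"
    have e: "e = 0 \<or> e = 1" by (simp add: e_def digit_def)
    have "of_int a' = of_int d * (of_int e + 2 * Q m r (T m r ?y))"
      using a'(2) Q_rec[of m r ?y] by (simp add: e_def)
    then have eq: "of_int (a' - d * e) = 2 * (of_int d * Q m r (T m r ?y))"
      by (simp add: algebra_simps)
    then have "even (a' - d * e)"
      by (metis Z2_two_dvd_of_int dvd_triv_left)
    then obtain b where b: "a' - d * e = 2 * b" by (elim evenE)
    have "of_int d * Q m r (T m r ?y) = of_int b"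
      by (rule Z2_mult_2_cancel) (use eq b in simp)
    moreover have "b \<in> {-B..B}"
      using a'(1) b e by (auto simp: B_def)
    ultimately show ?case by auto
  qed
  have inj: "inj (\<lambda>y. of_int d * Q m r y)"
    by (rule injI) (metis bij_Q[OF assms(1,2)] bij_is_inj injD odd_mult_Z2_ex1[OF d(1)])
  have "(\<lambda>y. of_int d * Q m r y) ` range (\<lambda>k. (T m r ^^ k) z) \<subseteq> of_int ` {-B..B}"
    using num by fastforce
  then have "finite ((\<lambda>y. of_int d * Q m r y) ` range (\<lambda>k. (T m r ^^ k) z))"
    by (rule finite_subset) simp
  then show ?thesis
    by (rule finite_imageD) (rule inj_on_subset[OF inj subset_UNIV])
qed

section \<open>The autoconjugacy and its truncations\<close>

lemma Q_Phi:
  assumes "odd m" "odd r"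
  shows "Q m r (Phi m r y) = y"
  unfolding Phi_def by (rule surj_f_inv_f) (simp add: bij_Q[OF assms] bij_is_surj)

lemma Phi_Q:
  assumes "odd m" "odd r"
  shows "Phi m r (Q m r y) = y"
  unfolding Phi_def by (rule inv_f_f) (simp add: bij_Q[OF assms] bij_is_inj)

text \<open>\<open>V\<close> complements every binary digit. Stated for an arbitrary tail \<open>s\<close> behind the leading digit
  of \<open>x\<close>, this gives one step of both \<open>Omega\<close> and \<open>Omega_trunc\<close>.\<close>

lemma Phi_V_step:
  assumes "odd m" "odd r"
  shows "2 dvd Phi m r (V (of_nat (digit m r x 0) + 2 * s)) \<longleftrightarrow> \<not> 2 dvd x"
    and "T m r (Phi m r (V (of_nat (digit m r x 0) + 2 * s))) = Phi m r (V s)"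
proof -
  define z where "z = Phi m r (V (of_nat (digit m r x 0) + 2 * s))"
  have z: "of_nat (digit m r z 0) + 2 * Q m r (T m r z) = V (of_nat (digit m r x 0) + 2 * s)"
    unfolding Q_rec[symmetric] by (simp add: z_def Q_Phi[OF assms])
  have "of_int (int (digit m r z 0) + int (digit m r x 0) + 1) = 2 * (- s - Q m r (T m r z))"
    using z by (simp add: V_def algebra_simps eq_neg_iff_add_eq_0)
  then have "even (int (digit m r z 0) + int (digit m r x 0) + 1)"
    by (metis Z2_two_dvd_of_int dvd_triv_left)
  then have par: "2 dvd z \<longleftrightarrow> \<not> 2 dvd x"
    by (simp add: digit_def split: if_splits)
  then show "2 dvd Phi m r (V (of_nat (digit m r x 0) + 2 * s)) \<longleftrightarrow> \<not> 2 dvd x"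
    by (simp add: z_def)
  have "2 * Q m r (T m r z) = V (of_nat (digit m r x 0) + 2 * s) - of_nat (digit m r z 0)"
    using z by (metis add_diff_cancel_left')
  also have "\<dots> = 2 * V s"
    using par by (cases "2 dvd x") (simp_all add: digit_def V_def)
  finally have "2 * Q m r (T m r z) = 2 * V s" .
  then have "Q m r (T m r z) = V s" by (rule Z2_mult_2_cancel)
  then show "T m r (Phi m r (V (of_nat (digit m r x 0) + 2 * s))) = Phi m r (V s)"
    by (metis Phi_Q[OF assms] z_def)
qed

lemma Omega_step:
  assumes "odd m" "odd r"
  shows "2 dvd Omega m r x \<longleftrightarrow> \<not> 2 dvd x"
    and "T m r (Omega m r x) = Omega m r (T m r x)"
  using Phi_V_step[OF assms, of x "Q m r (T m r x)"]
  unfolding Q_rec[of m r x, symmetric] by (simp_all add: Omega_def)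

lemma Omega_trunc_step:
  assumes "odd m" "odd r"
  shows "2 dvd Omega_trunc (Suc k) m r x \<longleftrightarrow> \<not> 2 dvd x"
    and "T m r (Omega_trunc (Suc k) m r x) = Omega_trunc k m r (T m r x)"
  using Phi_V_step[OF assms, of x "of_nat (Q_trunc k m r (T m r x))"]
  by (simp_all add: Omega_trunc_def Q_trunc_Suc)

lemma funpow_T_Omega:
  assumes "odd m" "odd r"
  shows "(T m r ^^ k) (Omega m r x) = Omega m r ((T m r ^^ k) x)"
  by (induction k) (simp_all add: Omega_step[OF assms])

lemma funpow_T_Omega_trunc:
  assumes "odd m" "odd r"
  shows "(T m r ^^ k) (Omega_trunc (k + l) m r x) = Omega_trunc l m r ((T m r ^^ k) x)"
proof (induction k arbitrary: x)
  case (Suc k)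
  show ?case
    unfolding add_Suc funpow_Suc_right comp_apply Omega_trunc_step(2)[OF assms] by (rule Suc)
qed simp

lemma parity_funpow_T_Omega_trunc:
  assumes "odd m" "odd r" and "i < k"
  shows "2 dvd (T m r ^^ i) (Omega_trunc k m r x) \<longleftrightarrow> \<not> 2 dvd (T m r ^^ i) x"
proof -
  obtain l where "k = i + Suc l" using assms(3) less_imp_Suc_add by auto
  then show ?thesis
    using funpow_T_Omega_trunc[OF assms(1,2)] Omega_trunc_step(1)[OF assms(1,2)] by metis
qed

section \<open>Convergence\<close>

lemma power_card_even_iterates_le:
  assumes "1 < m" and "nu m r x > ereal (ln 2 / ln (real_of_int m))"
  obtains q where "0 < q" "q < 1"
    and "\<forall>\<^sub>F k in sequentially.
      2 ^ k / of_int m ^ card {i. i < k \<and> 2 dvd (T m r ^^ i) x} \<le> (q :: real) ^ k"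
proof -
  let ?c = "\<lambda>k. card {i. i < k \<and> 2 dvd (T m r ^^ i) x}"
  have m: "real_of_int m > 1" using assms(1) by simp
  obtain t where t: "ln 2 / ln (real_of_int m) < t" "ereal t < nu m r x"
    using ereal_dense2[OF assms(2)] by auto
  \<comment> \<open>the average contraction rate belonging to a density \<open>t\<close> of even iterates\<close>
  define q where "q = 2 / real_of_int m powr t"
  have "ln 2 < t * ln (real_of_int m)"
    using t(1) m by (simp add: divide_less_eq)
  then have "exp (ln 2) < exp (t * ln (real_of_int m))"
    by (simp only: exp_less_cancel_iff)
  then have "2 < real_of_int m powr t"
    using m by (simp add: powr_def)
  then have q: "0 < q" "q < 1" using m by (simp_all add: q_def divide_less_eq)
  have "\<forall>\<^sub>F k in sequentially. ereal t < ereal (real (?c k) / real k)"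
    using t(2) unfolding nu_def by (rule less_LiminfD)
  then have "\<forall>\<^sub>F k in sequentially. 2 ^ k / of_int m ^ ?c k \<le> q ^ k"
    using eventually_gt_at_top[of 0]
  proof eventually_elim
    case (elim k)
    then have "t * real k \<le> real (?c k)" by (simp add: field_simps)
    then have "real_of_int m powr (t * real k) \<le> real_of_int m powr real (?c k)"
      using m by (intro powr_mono) auto
    then have "(real_of_int m powr t) ^ k \<le> real_of_int m ^ ?c k"
      using m by (simp add: powr_powr[symmetric] powr_realpow)
    moreover have "0 < (real_of_int m powr t) ^ k" using m by simp
    ultimately show ?case
      unfolding q_def power_divide by (intro divide_left_mono) auto
  qed
  with q show thesis by (rule that)
qed

text \<open>Two consecutive truncations share \<open>k\<close> parities, and their \<open>k\<close>-th iterates are the constant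
  \<open>c\<close> and one of its two preimages; \<open>C\<close> can therefore be chosen independently of \<open>k\<close> and \<open>x\<close>.\<close>

lemma Omega_trunc_diff_le:
  assumes "odd m" "odd r" "1 < m"
  obtains C where "\<And>k x. \<bar>real_of_Z2 (Omega_trunc (Suc k) m r x) - real_of_Z2 (Omega_trunc k m r x)\<bar>
    \<le> 2 ^ k / of_int m ^ card {i. i < k \<and> 2 dvd (T m r ^^ i) x} * C"
proof -
  define c where "c = Omega_trunc 0 m r 0"
  have c0: "Omega_trunc 0 m r y = c" for y by (simp add: c_def Omega_trunc_def)
  have diff: "\<bar>real_of_Z2 (Omega_trunc 1 m r y) - real_of_Z2 c\<bar> \<le>
      \<bar>real_of_Z2 c\<bar> + \<bar>2 * real_of_Z2 c\<bar> + \<bar>(2 * real_of_Z2 c - of_int r) / of_int m\<bar>" for y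
  proof -
    have T1: "T m r (Omega_trunc 1 m r y) = c"
      using Omega_trunc_step(2)[OF assms(1,2), of 0 y] by (simp add: c0)
    have "real_of_Z2 (Omega_trunc 1 m r y) = 2 * real_of_Z2 c
        \<or> real_of_Z2 (Omega_trunc 1 m r y) = (2 * real_of_Z2 c - of_int r) / of_int m"
      using real_of_Z2_T[OF assms(1,2) Omega_trunc_rats[OF assms(1,2)], of 1 y] assms(3)
      unfolding T1 by (auto simp: field_simps split: if_splits)
    then show ?thesis
      using abs_triangle_ineq4[of "2 * real_of_Z2 c" "real_of_Z2 c"]
        abs_triangle_ineq4[of "(2 * real_of_Z2 c - of_int r) / of_int m" "real_of_Z2 c"]
        abs_ge_zero[of "2 * real_of_Z2 c"]
        abs_ge_zero[of "(2 * real_of_Z2 c - of_int r) / of_int m"]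
      by (elim disjE) linarith+
  qed
  show thesis
  proof (rule that)
    fix k x
    let ?P = "2 ^ k / of_int m ^ card {i. i < k \<and> 2 dvd (T m r ^^ i) x} :: real"
    have "real_of_Z2 (Omega_trunc (Suc k) m r x) - real_of_Z2 (Omega_trunc k m r x)
      = ?P * (real_of_Z2 ((T m r ^^ k) (Omega_trunc (Suc k) m r x))
          - real_of_Z2 ((T m r ^^ k) (Omega_trunc k m r x)))"
      using assms by (intro real_of_Z2_diff_funpow_T Omega_trunc_rats parity_funpow_T_Omega_trunc) auto
    also have "\<dots> = ?P * (real_of_Z2 (Omega_trunc 1 m r ((T m r ^^ k) x)) - real_of_Z2 c)"
      using funpow_T_Omega_trunc[OF assms(1,2), of k 1 x]
        funpow_T_Omega_trunc[OF assms(1,2), of k 0 x] by (simp add: c0)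
    finally show "\<bar>real_of_Z2 (Omega_trunc (Suc k) m r x) - real_of_Z2 (Omega_trunc k m r x)\<bar> \<le> ?P *
        (\<bar>real_of_Z2 c\<bar> + \<bar>2 * real_of_Z2 c\<bar> + \<bar>(2 * real_of_Z2 c - of_int r) / of_int m\<bar>)"
      using diff assms(3) by (simp only: abs_mult) (intro mult_mono; simp)
  qed
qed

lemma convergent_Omega_trunc:
  assumes "odd m" "odd r" "1 < m"
    and "nu m r x > ereal (ln 2 / ln (real_of_int m))"
  shows "convergent (\<lambda>k. real_of_Z2 (Omega_trunc k m r x))"
proof -
  let ?z = "\<lambda>k. real_of_Z2 (Omega_trunc k m r x)"
  let ?P = "\<lambda>k. 2 ^ k / of_int m ^ card {i. i < k \<and> 2 dvd (T m r ^^ i) x} :: real"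
  obtain C where C: "\<And>k. \<bar>?z (Suc k) - ?z k\<bar> \<le> ?P k * C"
    using Omega_trunc_diff_le[OF assms(1-3)] by metis
  obtain q where q: "0 < q" "q < 1" "\<forall>\<^sub>F k in sequentially. ?P k \<le> q ^ k"
    by (rule power_card_even_iterates_le[OF assms(3,4)])
  have "\<forall>\<^sub>F k in sequentially. norm (?z (Suc k) - ?z k) \<le> q ^ k * \<bar>C\<bar>"
    using q(3)
  proof eventually_elim
    case (elim k)
    have "?P k * C \<le> ?P k * \<bar>C\<bar>" using assms(3) by (intro mult_left_mono) auto
    also have "\<dots> \<le> q ^ k * \<bar>C\<bar>" using elim by (intro mult_right_mono) auto
    finally show ?case using C[of k] by simp
  qed
  moreover have "summable (\<lambda>k. q ^ k * \<bar>C\<bar>)"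
    using q by (intro summable_mult2 summable_geometric) simp
  ultimately have "summable (\<lambda>k. ?z (Suc k) - ?z k)"
    by (rule summable_comparison_test_ev)
  then have "convergent (\<lambda>k. ?z k - ?z 0)"
    unfolding summable_iff_convergent sum_lessThan_telescope[of ?z] .
  then show ?thesis
    by (simp add: convergent_diff_const_right_iff)
qed

text \<open>Here the two \<open>k\<close>-th iterates are \<open>c\<close> and a point of the finite orbit of \<open>Omega m r x\<close>,
  so the geometrically decaying factor is multiplied by a bounded quantity.\<close>

lemma Omega_trunc_tendsto_Omega:
  assumes "odd m" "odd r" "1 < m"
    and "nu m r x > ereal (ln 2 / ln (real_of_int m))"
    and "Omega m r x \<in> Z2_rats" and "finite (range (\<lambda>k. (T m r ^^ k) (Omega m r x)))"
  shows "(\<lambda>k. real_of_Z2 (Omega_trunc k m r x)) \<longlonglongrightarrow> real_of_Z2 (Omega m r x)"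
proof -
  let ?z = "\<lambda>k. real_of_Z2 (Omega_trunc k m r x)"
  let ?w = "\<lambda>k. real_of_Z2 ((T m r ^^ k) (Omega m r x))"
  let ?P = "\<lambda>k. 2 ^ k / of_int m ^ card {i. i < k \<and> 2 dvd (T m r ^^ i) x} :: real"
  define c where "c = real_of_Z2 (Omega_trunc 0 m r 0)"
  have c0: "real_of_Z2 (Omega_trunc 0 m r y) = c" for y by (simp add: c_def Omega_trunc_def)
  obtain q where q: "0 < q" "q < 1" "\<forall>\<^sub>F k in sequentially. ?P k \<le> q ^ k"
    by (rule power_card_even_iterates_le[OF assms(3,4)])
  have diff: "?z k - real_of_Z2 (Omega m r x) = ?P k * (c - ?w k)" for k
  proof -
    have "?z k - real_of_Z2 (Omega m r x)
        = ?P k * (real_of_Z2 ((T m r ^^ k) (Omega_trunc k m r x)) - ?w k)"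
      using assms(1,2,5)
      by (intro real_of_Z2_diff_funpow_T Omega_trunc_rats parity_funpow_T_Omega_trunc)
        (simp_all add: funpow_T_Omega Omega_step)
    then show ?thesis
      using funpow_T_Omega_trunc[OF assms(1,2), of k 0 x] by (simp add: c0)
  qed
  have "finite ((\<lambda>y. \<bar>c - real_of_Z2 y\<bar>) ` range (\<lambda>k. (T m r ^^ k) (Omega m r x)))"
    using assms(6) by (rule finite_imageI)
  then have "bdd_above ((\<lambda>y. \<bar>c - real_of_Z2 y\<bar>) ` range (\<lambda>k. (T m r ^^ k) (Omega m r x)))"
    by (rule bdd_above_finite)
  then obtain B where "\<forall>v\<in>(\<lambda>y. \<bar>c - real_of_Z2 y\<bar>) ` range (\<lambda>k. (T m r ^^ k) (Omega m r x)). v \<le> B"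
    unfolding bdd_above_def by (rule exE)
  then have B: "\<bar>c - ?w k\<bar> \<le> B" for k
    by simp
  have "\<forall>\<^sub>F k in sequentially. norm (?z k - real_of_Z2 (Omega m r x)) \<le> norm (q ^ k) * B"
    using q(3)
  proof eventually_elim
    case (elim k)
    have "\<bar>?P k * (c - ?w k)\<bar> \<le> q ^ k * B"
      unfolding abs_mult using elim B assms(3) q(1) by (intro mult_mono) simp_all
    then show ?case using q(1) by (simp add: diff)
  qed
  moreover have "(\<lambda>k. q ^ k) \<longlonglongrightarrow> 0"
    using q by (intro LIMSEQ_realpow_zero) auto
  ultimately have "(\<lambda>k. ?z k - real_of_Z2 (Omega m r x)) \<longlonglongrightarrow> 0"
    by (rule tendsto_0_le[rotated])
  then show ?thesis by (simp add: LIM_zero_iff)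
qed

theorem theorem2:
  fixes m r :: int and x :: Z2
  assumes "odd m" and "odd r" and "1 < m"
    and "nu m r x > ereal (ln 2 / ln (real_of_int m))"
  shows "convergent (\<lambda>k. real_of_Z2 (Omega_trunc k m r x)) \<and>
    (Q m r x \<in> Z2_rats \<longrightarrow>
      Omega m r x \<in> Z2_rats \<and> Omega_hat m r x = real_of_Z2 (Omega m r x))"
proof (intro conjI impI)
  show "convergent (\<lambda>k. real_of_Z2 (Omega_trunc k m r x))"
    using assms by (rule convergent_Omega_trunc)
next
  assume "Q m r x \<in> Z2_rats"
  then have "Q m r (Omega m r x) \<in> Z2_rats"
    using Z2_rats_affine(1)[of "Q m r x" "- 1" "- 1"]
    by (simp add: Omega_def Q_Phi[OF assms(1,2)] V_def minus_diff_commute)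
  then have fin: "finite (range (\<lambda>k. (T m r ^^ k) (Omega m r x)))"
    using assms(1,2) by (intro finite_orbit_if_Q_rat)
  then show rat: "Omega m r x \<in> Z2_rats"
    using assms(1,2) by (intro finite_orbit_Z2_rats)
  show "Omega_hat m r x = real_of_Z2 (Omega m r x)"
    unfolding Omega_hat_def by (rule limI) (rule Omega_trunc_tendsto_Omega[OF assms rat fin])
qed

end
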